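(* Let $k\in\{2,3,4\}$. Then there is a constant $C>0$ and there are infinitely many $k$-tuples $(b_1,\ldots,b_k)$ of positive integers for each of which there is a positive integer $M$ with $b_j\leq C M^2$ for all $1\leq j\leq k$ and \[ 0<\left\|\sum_{j=1}^k\sqrt{b_j}\right\|\leq C\,M^{-(2k-1)}. \] Consequently, there are constants $C'>0$ and $N_0$ such that for every integer $N\geq N_0$, \[ g_{k,2}(N)\leq C'\,N^{-(k-1/2)}. \]
   Context: For a real number $x$, $\|x\|$ denotes the distance from $x$ to the nearest integer. For integers $k\ge 1$ and $N\geq 1$, define \[ g_{k,2}(N):=\min\left\{\left\|\sum_{j=1}^k\sqrt{b_j}\right\| : b_1,\ldots,b_k\in\mathbb{Z},\ 1\leq b_j\leq N \text{ for all } j,\ \sum_{j=1}^k\sqrt{b_j}\notin\mathbb{Z}\right\} \] (for $N\ge 2$ the set of admissible tuples is nonempty). *)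

theory Defs
  imports "HOL-Analysis.Analysis"
begin

definition dist_int :: "real \<Rightarrow> real" where
  "dist_int x = infdist x \<int>"

lemma dist_int_eq_round: "dist_int x = \<bar>x - of_int (round x)\<bar>"
proof (rule antisym)
  show "dist_int x \<le> \<bar>x - of_int (round x)\<bar>"
    unfolding dist_int_def dist_real_def [symmetric] by (rule infdist_le) simp
next
  have "\<bar>x - of_int (round x)\<bar> \<le> dist x a" if "a \<in> \<int>" for a
  proof -
    from that obtain m where "a = of_int m" by (elim Ints_cases)
    with round_diff_minimal [of x m] show ?thesis by (simp add: dist_real_def)
  qed
  then show "\<bar>x - of_int (round x)\<bar> \<le> dist_int x"
    unfolding dist_int_def by (subst infdist_notempty) (auto intro!: cINF_greatest)
qed

text \<open>A \<open>k\<close>-tuple of integers is represented by a list of length \<open>k\<close>.\<close>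

definition sqrt_sum :: "int list \<Rightarrow> real" where
  "sqrt_sum bs = (\<Sum>b\<leftarrow>bs. sqrt (of_int b))"

definition admissible :: "nat \<Rightarrow> nat \<Rightarrow> int list set" where
  "admissible k N =
     {bs. length bs = k \<and> (\<forall>b\<in>set bs. 1 \<le> b \<and> b \<le> int N) \<and> sqrt_sum bs \<notin> \<int>}"

lemma finite_admissible: "finite (admissible k N)"
  by (rule finite_subset [OF _ finite_lists_length_eq [of "{1..int N}" k]])
    (auto simp: admissible_def)

text \<open>For \<open>k \<ge> 1\<close> and \<open>N \<ge> 2\<close> the minimum ranges over a nonempty finite set;
  for \<open>N \<le> 1\<close> or \<open>k = 0\<close> there is no admissible tuple and the value is unspecified.\<close>

definition g2 :: "nat \<Rightarrow> nat \<Rightarrow> real" where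
  "g2 k N = Min ((\<lambda>bs. dist_int (sqrt_sum bs)) ` admissible k N)"

lemma admissible_nonempty:
  assumes "k \<ge> 1" "N \<ge> 2"
  shows "admissible k N \<noteq> {}"
proof -
  let ?bs = "2 # replicate (k - 1) (1 :: int)"
  have irr: "sqrt 2 \<notin> \<int>"
  proof
    assume "sqrt 2 \<in> \<int>"
    then obtain m where m: "sqrt 2 = of_int m" by (elim Ints_cases)
    have "1 < sqrt (2::real)" "sqrt (2::real) < 2"
      using sqrt2_less_2 by auto
    with m have "1 < m" "m < 2" by auto
    then show False by simp
  qed
  have s: "sqrt_sum ?bs = sqrt 2 + of_int (int (k - 1))"
    by (simp add: sqrt_sum_def sum_list_replicate)
  have "sqrt_sum ?bs \<notin> \<int>"
  proof
    assume "sqrt_sum ?bs \<in> \<int>"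
    then have "sqrt_sum ?bs - of_int (int (k - 1)) \<in> \<int>" by (intro Ints_diff Ints_of_int)
    with s irr show False by simp
  qed
  then have "?bs \<in> admissible k N"
    using assms by (auto simp: admissible_def)
  then show ?thesis by blast
qed

end

theory Submission
  imports Defs "HOL-Real_Asymp.Real_Asymp"
begin

text \<open>
  The idea is to make each \<open>b\<^sub>j\<close> a quadratic polynomial in \<open>n\<close> with square leading coefficient,
  \<open>b\<^sub>j = a\<^sub>j\<^sup>2 ((n + x\<^sub>j)\<^sup>2 + \<delta>\<^sub>j)\<close>.  At infinity \<open>\<surd>b\<^sub>j\<close> is then \<open>a\<^sub>j (n + x\<^sub>j)\<close> plus a series in
  \<open>1/n\<close>, so that the sum of the roots is an integer plus a series in \<open>1/n\<close>.  If the coefficients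
  of \<open>1/n, \<dots>, 1/n\<^bsup>2k-2\<^esup>\<close> cancel and that of \<open>1/n\<^bsup>2k-1\<^esup>\<close> does not, the sum is, for all large
  \<open>n\<close>, at a positive distance of exact order \<open>n\<^bsup>-(2k-1)\<^esup>\<close> from an integer, while \<open>b\<^sub>j = O(n\<^sup>2)\<close>.

  From
  \<open>\<surd>((n + x)\<^sup>2 + \<delta>) = (n + x) + \<delta> / (2 (n + x)) - \<delta>\<^sup>2 / (8 (n + x)\<^sup>3) + \<delta>\<^sup>3 / (16 (n + x)\<^sup>5) - \<dots>\<close>
  the even powers of \<open>1/n\<close> disappear as soon as the triples \<open>(a\<^sub>j, x\<^sub>j, \<delta>\<^sub>j)\<close> are symmetric under
  \<open>x \<mapsto> -x\<close>, and the coefficients of \<open>1/n\<close>, \<open>1/n\<^sup>3\<close>, \<open>1/n\<^sup>5\<close> vanish iff the respective sums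
  \<open>\<Sum> a \<delta>\<close>, \<open>\<Sum> a \<delta> (4 x\<^sup>2 - \<delta>)\<close>, \<open>\<Sum> a \<delta> (8 x\<^sup>4 - 12 \<delta> x\<^sup>2 + \<delta>\<^sup>2)\<close>
  do.  They have to be solved in rationals with all \<open>a > 0\<close>; denominators can then be cleared,
  because a common factor of the \<open>a\<^sub>j\<close> only multiplies the sum of the roots.  If all \<open>x\<close> are
  \<open>0\<close>, the second sum is negative unless all \<open>\<delta>\<close> vanish, so that shifts are unavoidable for \<open>k \<ge> 3\<close>.  For
  \<open>k \<in> {2, 3, 4}\<close> the first \<open>k - 1\<close> of the sums vanish for the following triples
  \<open>(a, x, \<delta>)\<close>.

  \<^item> \<open>k = 2\<close>: \<open>(1, 0, 1)\<close>, \<open>(1, 0, -1)\<close>.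
  \<^item> \<open>k = 3\<close>: \<open>(1, \<plusminus>1, 2)\<close>, \<open>(2, 0, -2)\<close>.
  \<^item> \<open>k = 4\<close>: \<open>(3, \<plusminus>1, 1)\<close>, \<open>(1, 0, 3)\<close>, \<open>(9, 0, -1)\<close>.

  The limits \<open>approx_two_roots\<close>, \<open>approx_three_roots\<close> and \<open>approx_four_roots\<close> record the outcome, and
  \<open>nearly_integral_family\<close> deduces the theorem from any such family.  The bound for every large
  \<open>N\<close> follows by taking the largest \<open>n\<close> with \<open>K n\<^sup>2 \<le> N\<close>, where \<open>b\<^sub>j \<le> K n\<^sup>2\<close>; this \<open>n\<close> is
  of order \<open>\<surd>N\<close>.
\<close>

lemma dist_int_eq_abs_diff:
  assumes "\<bar>x - of_int m\<bar> < 1/2"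
  shows "dist_int x = \<bar>x - of_int m\<bar>"
  using round_unique' [OF assms] by (simp add: dist_int_eq_round)

lemma dist_int_of_Ints:
  assumes "x \<in> \<int>"
  shows "dist_int x = 0"
  using assms by (auto simp: dist_int_def)

text \<open>The lower bound is where the nonzero limit matters: it keeps the sums from being integers.\<close>

lemma eventually_dist_int_bounds:
  fixes s :: "nat \<Rightarrow> real" and L :: "nat \<Rightarrow> int"
  assumes lim: "(\<lambda>n. real n ^ p * (s n - of_int (L n))) \<longlonglongrightarrow> c"
    and "c \<noteq> 0" "p > 0"
  shows "\<forall>\<^sub>F n in sequentially. 0 < dist_int (s n) \<and> dist_int (s n) \<le> (\<bar>c\<bar> + 1) / real n ^ p"
proof -
  have "(\<lambda>n. (\<bar>c\<bar> + 1) / real n ^ p) \<longlonglongrightarrow> 0"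
    using \<open>p > 0\<close> by real_asymp
  then have small: "\<forall>\<^sub>F n in sequentially. (\<bar>c\<bar> + 1) / real n ^ p < 1/2"
    by (rule order_tendstoD) simp
  have abs_lim: "(\<lambda>n. \<bar>real n ^ p * (s n - of_int (L n))\<bar>) \<longlonglongrightarrow> \<bar>c\<bar>"
    using lim by (rule tendsto_rabs)
  have upper: "\<forall>\<^sub>F n in sequentially. \<bar>real n ^ p * (s n - of_int (L n))\<bar> < \<bar>c\<bar> + 1"
    using abs_lim by (rule order_tendstoD) simp
  have lower: "\<forall>\<^sub>F n in sequentially. 0 < \<bar>real n ^ p * (s n - of_int (L n))\<bar>"
    using abs_lim by (rule order_tendstoD) (use \<open>c \<noteq> 0\<close> in simp)
  from small upper lower eventually_gt_at_top [of 0] show ?thesis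
  proof eventually_elim
    case (elim n)
    let ?e = "\<bar>s n - of_int (L n)\<bar>"
    have le: "?e \<le> (\<bar>c\<bar> + 1) / real n ^ p"
    proof -
      have "real n ^ p * ?e \<le> \<bar>c\<bar> + 1"
        using elim by (simp add: abs_mult)
      then show ?thesis using elim by (simp add: pos_le_divide_eq mult.commute)
    qed
    have "0 < ?e"
      using elim by (auto simp: abs_mult zero_less_mult_iff)
    moreover have "dist_int (s n) = ?e"
      using le elim by (intro dist_int_eq_abs_diff) linarith
    ultimately show ?case using le by simp
  qed
qed

lemma g2_le:
  assumes "length bs = k" "\<forall>b\<in>set bs. 0 < b \<and> b \<le> int N" "0 < dist_int (sqrt_sum bs)"
  shows "g2 k N \<le> dist_int (sqrt_sum bs)"
proof -
  have "bs \<in> admissible k N"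
    using assms dist_int_of_Ints [of "sqrt_sum bs"] by (fastforce simp: admissible_def)
  then show ?thesis
    unfolding g2_def by (intro Min_le) (auto simp: finite_admissible)
qed

text \<open>
  A single family of tuples, in place of tuples found separately for each \<open>N\<close>, suffices for
  both conclusions because its parameter \<open>n\<close> runs through all large integers: consecutive scales
  \<open>K n\<^sup>2\<close> have bounded ratio, so no \<open>N\<close> is missed by more than a constant factor.
\<close>

lemma nearly_integral_family:
  fixes k :: nat and f :: "nat \<Rightarrow> int list" and L :: "nat \<Rightarrow> int" and K c :: real
  assumes len: "\<And>n. length (f n) = k" and "k > 0" "K > 0"
    and size: "\<forall>\<^sub>F n in sequentially. \<forall>b\<in>set (f n). 0 < b \<and> of_int b \<le> K * real n ^ 2"
    and lim: "(\<lambda>n. real n ^ (2 * k - 1) * (sqrt_sum (f n) - of_int (L n))) \<longlonglongrightarrow> c" and "c \<noteq> 0"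
  shows "(\<exists>C>0. infinite {bs :: int list. length bs = k \<and> (\<forall>b\<in>set bs. b > 0) \<and>
            (\<exists>M::nat. M > 0 \<and>
               (\<forall>b\<in>set bs. of_int b \<le> C * real M ^ 2) \<and>
               0 < dist_int (sqrt_sum bs) \<and>
               dist_int (sqrt_sum bs) \<le> C * real M powi (- (2 * int k - 1)))})
       \<and> (\<exists>C'>0. \<exists>N\<^sub>0::nat. \<forall>N\<ge>N\<^sub>0. g2 k N \<le> C' * real N powr (- (real k - 1/2)))"
proof
  define p where "p = 2 * k - 1"
  define D where "D = \<bar>c\<bar> + 1"
  define d where "d n = dist_int (sqrt_sum (f n))" for n
  have "p > 0" "D > 0"
    using \<open>k > 0\<close> by (simp_all add: p_def D_def)
  have "\<forall>\<^sub>F n in sequentially. 0 < d n \<and> d n \<le> D / real n ^ p"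
    unfolding d_def D_def
    by (rule eventually_dist_int_bounds [OF lim [folded p_def] \<open>c \<noteq> 0\<close> \<open>p > 0\<close>])
  with size have "\<forall>\<^sub>F n in sequentially.
      (\<forall>b\<in>set (f n). 0 < b \<and> of_int b \<le> K * real n ^ 2) \<and> 0 < d n \<and> d n \<le> D / real n ^ p"
    by eventually_elim simp
  then obtain n\<^sub>0 where n\<^sub>0:
    "(\<forall>b\<in>set (f n). 0 < b \<and> of_int b \<le> K * real n ^ 2) \<and> 0 < d n \<and> d n \<le> D / real n ^ p"
    if "n \<ge> n\<^sub>0" for n
    by (auto simp: eventually_sequentially)

  show "\<exists>C>0. infinite {bs :: int list. length bs = k \<and> (\<forall>b\<in>set bs. b > 0) \<and>
            (\<exists>M::nat. M > 0 \<and>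
               (\<forall>b\<in>set bs. of_int b \<le> C * real M ^ 2) \<and>
               0 < dist_int (sqrt_sum bs) \<and>
               dist_int (sqrt_sum bs) \<le> C * real M powi (- (2 * int k - 1)))}"
  proof (intro exI conjI)
    let ?C = "max K D"
    let ?S = "{bs :: int list. length bs = k \<and> (\<forall>b\<in>set bs. b > 0) \<and>
            (\<exists>M::nat. M > 0 \<and>
               (\<forall>b\<in>set bs. of_int b \<le> ?C * real M ^ 2) \<and>
               0 < dist_int (sqrt_sum bs) \<and>
               dist_int (sqrt_sum bs) \<le> ?C * real M powi (- (2 * int k - 1)))}"
    show "?C > 0" using \<open>K > 0\<close> by simp
    have member: "f n \<in> ?S" if n: "n \<ge> n\<^sub>0" "n > 0" for n
    proof -
      have "of_int b \<le> ?C * real n ^ 2" if "b \<in> set (f n)" for b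
      proof -
        have "of_int b \<le> K * real n ^ 2" using n\<^sub>0 [OF n(1)] that by blast
        also have "\<dots> \<le> ?C * real n ^ 2" by (intro mult_right_mono) auto
        finally show ?thesis .
      qed
      moreover have "d n \<le> ?C * real n powi (- (2 * int k - 1))"
      proof -
        have "2 * int k - 1 = int p" using \<open>k > 0\<close> by (simp add: p_def)
        then have "real n powi (- (2 * int k - 1)) = 1 / real n ^ p"
          by (simp add: power_int_minus field_simps)
        moreover have "d n \<le> D * (1 / real n ^ p)" using n\<^sub>0 [OF n(1)] by simp
        moreover have "D * (1 / real n ^ p) \<le> ?C * (1 / real n ^ p)"
          by (intro mult_right_mono) auto
        ultimately show ?thesis by simp
      qed
      ultimately show ?thesis
        using n\<^sub>0 [OF n(1)] n(2) len by (auto simp: d_def intro!: exI [of _ n])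
    qed
    \<comment> \<open>The distances are positive and tend to \<open>0\<close>, so finitely many tuples cannot realise them.\<close>
    show "infinite ?S"
    proof
      assume fin: "finite ?S"
      define V where "V = (\<lambda>bs. dist_int (sqrt_sum bs)) ` ?S"
      have d_in_V: "d n \<in> V" if "n \<ge> n\<^sub>0" "n > 0" for n
        unfolding V_def d_def using member [OF that] by (rule imageI)
      have "finite V" unfolding V_def using fin by (rule finite_imageI)
      moreover have "V \<noteq> {}" using d_in_V [of "Suc n\<^sub>0"] by auto
      moreover have "\<forall>v\<in>V. v > 0" unfolding V_def by auto
      ultimately have "Min V > 0" by simp
      moreover have "(\<lambda>n. D / real n ^ p) \<longlonglongrightarrow> 0"
        using \<open>p > 0\<close> by real_asymp
      ultimately have "\<forall>\<^sub>F n in sequentially. D / real n ^ p < Min V"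
        by (intro order_tendstoD)
      then have "\<forall>\<^sub>F n in sequentially. D / real n ^ p < Min V \<and> n \<ge> n\<^sub>0 \<and> n > 0"
        by (intro eventually_conj eventually_ge_at_top eventually_gt_at_top)
      then obtain n where n: "D / real n ^ p < Min V" "n \<ge> n\<^sub>0" "n > 0"
        using eventually_happens sequentially_bot by blast
      have "Min V \<le> d n" using \<open>finite V\<close> d_in_V [OF n(2,3)] by simp
      with n\<^sub>0 [OF n(2)] n(1) show False by linarith
    qed
  qed

  show "\<exists>C'>0. \<exists>N\<^sub>0::nat. \<forall>N\<ge>N\<^sub>0. g2 k N \<le> C' * real N powr (- (real k - 1/2))"
  proof (intro exI conjI allI impI)
    let ?r = "real k - 1/2"
    let ?C = "D * 2 ^ p * K powr ?r"
    let ?N\<^sub>0 = "nat \<lceil>K * (real n\<^sub>0 + 2) ^ 2\<rceil>"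
    show "?C > 0" using \<open>D > 0\<close> \<open>K > 0\<close> by simp
    fix N assume "N \<ge> ?N\<^sub>0"
    then have N: "real N \<ge> K * (real n\<^sub>0 + 2) ^ 2" by linarith
    define y where "y = sqrt (real N / K)"
    define n where "n = nat \<lfloor>y\<rfloor>"
    have y: "y \<ge> real n\<^sub>0 + 2"
      unfolding y_def using N \<open>K > 0\<close> by (intro real_le_rsqrt) (simp add: field_simps)
    then have "n \<ge> n\<^sub>0" and n_le: "real n \<le> y" and n_ge: "y / 2 \<le> real n"
      unfolding n_def by linarith+
    have "y > 0" using y by linarith
    have "N > 0"
      using \<open>y > 0\<close> by (cases N) (auto simp: y_def)
    have "K * real n ^ 2 \<le> K * y ^ 2"
      using n_le \<open>K > 0\<close> by (intro mult_left_mono power_mono) auto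
    also have "\<dots> = real N" using \<open>K > 0\<close> by (simp add: y_def)
    finally have "\<forall>b\<in>set (f n). 0 < b \<and> b \<le> int N"
      using n\<^sub>0 [OF \<open>n \<ge> n\<^sub>0\<close>] by (force intro: order_trans)
    then have "g2 k N \<le> d n"
      unfolding d_def using n\<^sub>0 [OF \<open>n \<ge> n\<^sub>0\<close>] len by (intro g2_le) (auto simp: d_def)
    also have "\<dots> \<le> D / real n ^ p" using n\<^sub>0 [OF \<open>n \<ge> n\<^sub>0\<close>] by blast
    also have "\<dots> \<le> D / (y / 2) ^ p"
      using n_ge \<open>y > 0\<close> \<open>D > 0\<close> by (intro divide_left_mono power_mono) auto
    also have "\<dots> = D * 2 ^ p / y ^ p" by (simp add: power_divide)
    also have "y ^ p = (real N / K) powr ?r"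
    proof -
      have "y ^ p = y powr real p" using \<open>y > 0\<close> by (simp add: powr_realpow)
      also have "\<dots> = ((real N / K) powr (1/2)) powr real p"
        using \<open>K > 0\<close> by (simp add: y_def powr_half_sqrt)
      also have "\<dots> = (real N / K) powr ?r"
        using \<open>k > 0\<close> by (simp add: powr_powr p_def field_simps)
      finally show ?thesis .
    qed
    also have "D * 2 ^ p / (real N / K) powr ?r = ?C * real N powr (- ?r)"
      using \<open>K > 0\<close> by (simp only: powr_divide powr_minus) (simp add: divide_simps)
    finally show "g2 k N \<le> ?C * real N powr (- ?r)" .
  qed
qed

text \<open>
  The values of the limits only matter for being nonzero: they are the coefficients of
  \<open>1/n\<^bsup>2k-1\<^esup>\<close>, and a zero would leave open whether the sums are integers.
\<close>

lemma approx_two_roots: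
  "(\<lambda>n. real n ^ 3 * (sqrt (real n ^ 2 + 1) + sqrt (real n ^ 2 - 1) - 2 * real n))
     \<longlonglongrightarrow> - 1/4"
  by real_asymp

lemma approx_three_roots:
  "(\<lambda>n. real n ^ 5 * (sqrt (real n ^ 2 + 2 * real n + 3) + sqrt (real n ^ 2 - 2 * real n + 3)
      + sqrt (4 * real n ^ 2 - 8) - 4 * real n)) \<longlonglongrightarrow> - 4"
  by real_asymp

lemma approx_four_roots:
  "(\<lambda>n. real n ^ 7 * (sqrt (9 * real n ^ 2 + 18 * real n + 18)
      + sqrt (9 * real n ^ 2 - 18 * real n + 18) + sqrt (real n ^ 2 + 3)
      + sqrt (81 * real n ^ 2 - 81) - 16 * real n)) \<longlonglongrightarrow> - 51/8"
  by real_asymp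

theorem proposition5p2:
  fixes k :: nat
  assumes "k \<in> {2, 3, 4}"
  shows "(\<exists>C>0. infinite {bs :: int list. length bs = k \<and> (\<forall>b\<in>set bs. b > 0) \<and>
            (\<exists>M::nat. M > 0 \<and>
               (\<forall>b\<in>set bs. of_int b \<le> C * real M ^ 2) \<and>
               0 < dist_int (sqrt_sum bs) \<and>
               dist_int (sqrt_sum bs) \<le> C * real M powi (- (2 * int k - 1)))})
       \<and> (\<exists>C'>0. \<exists>N\<^sub>0::nat. \<forall>N\<ge>N\<^sub>0. g2 k N \<le> C' * real N powr (- (real k - 1/2)))"
proof -
  consider "k = 2" | "k = 3" | "k = 4" using assms by blast
  then show ?thesis
  proof cases
    case 1
    let ?f = "\<lambda>n. [int n ^ 2 + 1, int n ^ 2 - 1]"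
    have size: "\<forall>\<^sub>F n in sequentially. \<forall>b\<in>set (?f n). 0 < b \<and> of_int b \<le> 2 * real n ^ 2"
      unfolding of_int_0_less_iff [where ?'a = real, symmetric]
      by (simp add: eventually_conj_iff del: of_int_0_less_iff; intro conjI; real_asymp)
    show ?thesis
      by (rule nearly_integral_family [where f = ?f and L = "\<lambda>n. 2 * int n" and c = "- 1/4",
          OF _ _ _ size])
        (use approx_two_roots 1 in \<open>simp_all add: sqrt_sum_def add_ac\<close>)
  next
    case 2
    let ?f = "\<lambda>n. [int n ^ 2 + 2 * int n + 3, int n ^ 2 - 2 * int n + 3, 4 * int n ^ 2 - 8]"
    have size: "\<forall>\<^sub>F n in sequentially. \<forall>b\<in>set (?f n). 0 < b \<and> of_int b \<le> 4 * real n ^ 2"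
      unfolding of_int_0_less_iff [where ?'a = real, symmetric]
      by (simp add: eventually_conj_iff del: of_int_0_less_iff; intro conjI; real_asymp)
    show ?thesis
      by (rule nearly_integral_family [where f = ?f and L = "\<lambda>n. 4 * int n" and c = "- 4",
          OF _ _ _ size])
        (use approx_three_roots 2 in \<open>simp_all add: sqrt_sum_def add_ac\<close>)
  next
    case 3
    let ?f = "\<lambda>n. [9 * int n ^ 2 + 18 * int n + 18, 9 * int n ^ 2 - 18 * int n + 18,
      int n ^ 2 + 3, 81 * int n ^ 2 - 81]"
    have size: "\<forall>\<^sub>F n in sequentially. \<forall>b\<in>set (?f n). 0 < b \<and> of_int b \<le> 81 * real n ^ 2"
      unfolding of_int_0_less_iff [where ?'a = real, symmetric]
      by (simp add: eventually_conj_iff del: of_int_0_less_iff; intro conjI; real_asymp)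
    show ?thesis
      by (rule nearly_integral_family [where f = ?f and L = "\<lambda>n. 16 * int n" and c = "- 51/8",
          OF _ _ _ size])
        (use approx_four_roots 3 in \<open>simp_all add: sqrt_sum_def add_ac\<close>)
  qed
qed

end
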